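(* For $n\ge1$ and $0\le c<n$, $$f(n,c,x)=\sum_{i=1}^{n}x^{\Delta(n,c,i)}\,f(i-1,c,x)\,f(n-i,c+1,x),$$ where $$\Delta(n,c,i)=\min\{c,\ i-1,\ n-c,\ n-i+1\}.$$ The initial and boundary conditions are $f(0,c,x)=1$ and $f(n,c,x)=C_n$ for $c\ge n$, where $C_n$ is the $n$th Catalan number. In particular, $f_{231}(n,x)=f(n,0,x)$.
   Context: $\mathfrak S_n$ is the set of permutations of $\{1,\dots,n\}$ and $\operatorname{Av}_n(231)$ is the set of $\pi\in\mathfrak S_n$ with no subsequence order-isomorphic to $231$. $\operatorname{DD}(\pi)$ is the number of indices $k$ with $\pi(k)<k<\pi^{-1}(k)$ (double deficiencies), and $f_{231}(n,x)=\sum_{\pi\in\operatorname{Av}_n(231)}x^{\operatorname{DD}(\pi)}$. For $\pi\in\mathfrak S_n$ and $c\in\mathbb Z$, the number of shifted double deficiencies of $\pi$ with shift $c$ is $$\operatorname{DD}_c(\pi)=\#\{j\in\{1,\ldots,n\}: 1\le j+c\le n,\ \pi(j)<j+c<\pi^{-1}(j+c)+c\}.$$ For $n\ge 0$ and $c\ge 0$, $f(n,c,x)=\sum_{\pi\in\operatorname{Av}_n(231)}x^{\operatorname{DD}_c(\pi)}$. $C_n=\frac1{n+1}\binom{2n}{n}$. *)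

theory Defs
  imports Complex_Main "HOL-Library.Sublist" "HOL-Combinatorics.Permutations"
begin

text \<open>
  The set of permutations of \<open>{1..n}\<close> is \<open>{\<pi>. \<pi> permutes {1..n}}\<close>: functions on
  \<open>nat\<close> that are bijective and fix every point outside \<open>{1..n}\<close>, so that \<open>inv \<pi>\<close> is
  the inverse permutation.
\<close>

definition one_line :: "nat \<Rightarrow> (nat \<Rightarrow> nat) \<Rightarrow> nat list" where
  "one_line n \<pi> = map \<pi> [1..<Suc n]"

definition order_isomorphic :: "nat list \<Rightarrow> nat list \<Rightarrow> bool" where
  "order_isomorphic xs ys \<longleftrightarrow> length xs = length ys \<and>
     (\<forall>i<length xs. \<forall>j<length xs. xs ! i < xs ! j \<longleftrightarrow> ys ! i < ys ! j)"

definition Av :: "nat \<Rightarrow> nat list \<Rightarrow> (nat \<Rightarrow> nat) set" where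
  "Av n \<sigma> = {\<pi>. \<pi> permutes {1..n} \<and>
     \<not> (\<exists>xs. subseq xs (one_line n \<pi>) \<and> order_isomorphic xs \<sigma>)}"

definition DD :: "nat \<Rightarrow> (nat \<Rightarrow> nat) \<Rightarrow> nat" where
  "DD n \<pi> = card {k \<in> {1..n}. \<pi> k < k \<and> k < inv \<pi> k}"

definition shifted_DD :: "nat \<Rightarrow> int \<Rightarrow> (nat \<Rightarrow> nat) \<Rightarrow> nat" where
  "shifted_DD n c \<pi> = card {j \<in> {1..n}. 1 \<le> int j + c \<and> int j + c \<le> int n \<and>
     int (\<pi> j) < int j + c \<and> int j + c < int (inv \<pi> (nat (int j + c))) + c}"

text \<open>
  The variable \<open>x\<close> ranges over an arbitrary commutative semiring, which includes
  the formal indeterminate \<open>[:0, 1:]\<close> of a polynomial ring; an identity that holds for all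
  such \<open>x\<close> is therefore in particular an identity of polynomials.
\<close>

definition f231 :: "nat \<Rightarrow> 'a::comm_semiring_1 \<Rightarrow> 'a" where
  "f231 n x = (\<Sum>\<pi>\<in>Av n [2, 3, 1]. x ^ DD n \<pi>)"

definition f :: "nat \<Rightarrow> nat \<Rightarrow> 'a::comm_semiring_1 \<Rightarrow> 'a" where
  "f n c x = (\<Sum>\<pi>\<in>Av n [2, 3, 1]. x ^ shifted_DD n (int c) \<pi>)"

text \<open>
  The subtractions below do not truncate in the range \<open>1 \<le> i \<le> n\<close>, \<open>c < n\<close>
  where \<open>\<Delta>\<close> is used.
\<close>

definition \<Delta> :: "nat \<Rightarrow> nat \<Rightarrow> nat \<Rightarrow> nat" where
  "\<Delta> n c i = Min {c, i - 1, n - c, n - i + 1}"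

definition catalan :: "nat \<Rightarrow> nat" where
  "catalan n = ((2 * n) choose n) div (n + 1)"

text \<open>The division is exact:\<close>

lemma real_catalan: "real (catalan n) = 1 / real (n + 1) * real ((2 * n) choose n)"
proof -
  have "Suc n * ((2 * n) choose Suc n) = n * ((2 * n) choose n)"
    using binomial_absorb_comp[of "2 * n" n] binomial_absorption[of n "2 * n"]
    by (simp add: mult_2)
  then have "(n + 1) * ((2 * n) choose n) = (n + 1) * ((2 * n) choose Suc n) + ((2 * n) choose n)"
    by simp
  then have "(n + 1) dvd ((2 * n) choose n)"
    by (metis dvd_add_right_iff dvd_triv_left)
  then show ?thesis
    unfolding catalan_def by (simp add: real_of_nat_div del: of_nat_add of_nat_Suc)
qed

end

theory Submission
  imports Defs
begin

text \<open>
  Let \<open>p\<close> avoid 231 and let its largest entry \<open>n\<close> stand at position \<open>i\<close>. An entry left of \<open>n\<close>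
  that exceeds an entry right of \<open>n\<close> would form a 231 together with \<open>n\<close>. So the entries left of
  \<open>n\<close> are \<open>1..i-1\<close> and those right of it are \<open>i..n-1\<close>: on the left \<open>p\<close> is a 231-avoiding
  permutation \<open>\<sigma>\<close> of \<open>1..i-1\<close>, and on the right it is a 231-avoiding permutation \<open>\<tau>\<close> of
  \<open>1..n-i\<close> with positions raised by \<open>i\<close> and values raised by \<open>i-1\<close>. Conversely every such pair
  can be glued together (\<open>bij_betw_glue\<close>).

  A shifted double deficiency is a condition on a position \<open>j\<close> and the value \<open>j + c\<close>. If both lie
  in the left block, it is a shifted double deficiency of \<open>\<sigma>\<close> with the same shift. If both lie in
  the right block, it is one of \<open>\<tau>\<close> with shift \<open>c + 1\<close>, since positions have been raised by one
  more than values. If \<open>j\<close> is left of \<open>n\<close> and the value \<open>j + c\<close> is at least \<open>i\<close>, the condition holds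
  automatically, because \<open>p j < i \<le> j + c\<close> and the value \<open>j + c\<close> stands at position \<open>i\<close> or later;
  the number of such \<open>j\<close> is \<open>\<Delta> n c i\<close>. No other \<open>j\<close> contributes (\<open>shifted_DD_glue\<close>), and
  summing over all glued pairs gives the recursion.

  For \<open>c \<ge> n\<close> no value \<open>j + c\<close> exists, so \<open>f n c x\<close> counts the 231-avoiding permutations. Gluing
  shows that these numbers satisfy the Catalan convolution, which the binomial formula
  also satisfies (\<open>catalan_convolution\<close>).
\<close>

section \<open>Avoidance of 231 in terms of positions\<close>

lemma subseq_Cons_map_upt:
  "subseq (a # xs) (map p [m..<n]) \<longleftrightarrow>
     (\<exists>i. m \<le> i \<and> i < n \<and> p i = a \<and> subseq xs (map p [Suc i..<n]))"
proof (induction "n - m" arbitrary: m)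
  case 0
  then show ?case by simp
next
  case (Suc d)
  then have "m < n" and IH: "subseq (a # xs) (map p [Suc m..<n]) \<longleftrightarrow>
     (\<exists>i. Suc m \<le> i \<and> i < n \<and> p i = a \<and> subseq xs (map p [Suc i..<n]))"
    by auto
  have "subseq (a # xs) (map p [m..<n]) \<longleftrightarrow>
      (p m = a \<and> subseq xs (map p [Suc m..<n])) \<or> subseq (a # xs) (map p [Suc m..<n])"
    using \<open>m < n\<close> subseq_Cons'[of a xs "map p [Suc m..<n]"]
    by (cases "p m = a") (simp_all add: upt_conv_Cons, blast)
  also have "\<dots> \<longleftrightarrow> (\<exists>i. m \<le> i \<and> i < n \<and> p i = a \<and> subseq xs (map p [Suc i..<n]))"
    unfolding IH
  proof (intro iffI; elim disjE exE conjE)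
    fix i
    assume "m \<le> i" "i < n" "p i = a" "subseq xs (map p [Suc i..<n])"
    then show "(p m = a \<and> subseq xs (map p [Suc m..<n])) \<or>
        (\<exists>i. Suc m \<le> i \<and> i < n \<and> p i = a \<and> subseq xs (map p [Suc i..<n]))"
      by (cases "i = m") (simp, intro disjI2 exI[of _ i], simp)
  next
    assume "p m = a" "subseq xs (map p [Suc m..<n])"
    then show "\<exists>i. m \<le> i \<and> i < n \<and> p i = a \<and> subseq xs (map p [Suc i..<n])"
      using \<open>m < n\<close> by (intro exI[of _ m]) simp
  next
    fix i
    assume "Suc m \<le> i" "i < n" "p i = a" "subseq xs (map p [Suc i..<n])"
    then show "\<exists>i. m \<le> i \<and> i < n \<and> p i = a \<and> subseq xs (map p [Suc i..<n])"
      by (intro exI[of _ i]) simp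
  qed
  finally show ?case .
qed

lemma order_isomorphic_231_iff:
  "order_isomorphic xs [2, 3, 1] \<longleftrightarrow> (\<exists>a b c. xs = [a, b, c] \<and> c < a \<and> a < b)"
proof
  assume iso: "order_isomorphic xs [2, 3, 1]"
  then have "length xs = 3" by (simp add: order_isomorphic_def)
  then obtain a b c where xs: "xs = [a, b, c]"
    by (auto simp: numeral_3_eq_3 length_Suc_conv)
  with iso show "\<exists>a b c. xs = [a, b, c] \<and> c < a \<and> a < b"
    by (auto simp: order_isomorphic_def All_less_Suc)
next
  assume "\<exists>a b c. xs = [a, b, c] \<and> c < a \<and> a < b"
  then obtain a b c where xs: "xs = [a, b, c]" and "c < a" "a < b" by blast
  then show "order_isomorphic xs [2, 3, 1]"
    by (simp add: order_isomorphic_def All_less_Suc)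
qed

text \<open>
  With positions in place of subwords, an occurrence is moved between a permutation and its
  blocks by shifting indices.
\<close>

definition avoids_231 :: "nat \<Rightarrow> (nat \<Rightarrow> nat) \<Rightarrow> bool" where
  "avoids_231 n p \<longleftrightarrow>
     \<not> (\<exists>a b c. 1 \<le> a \<and> a < b \<and> b < c \<and> c \<le> n \<and> p c < p a \<and> p a < p b)"

lemma Av_231: "Av n [2, 3, 1] = {p. p permutes {1..n} \<and> avoids_231 n p}"
proof -
  have "(\<exists>xs. subseq xs (one_line n p) \<and> order_isomorphic xs [2, 3, 1]) \<longleftrightarrow> \<not> avoids_231 n p" for p
  proof
    assume "\<exists>xs. subseq xs (one_line n p) \<and> order_isomorphic xs [2, 3, 1]"
    then obtain u v w where "subseq [u, v, w] (one_line n p)" and uvw: "w < u" "u < v"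
      unfolding order_isomorphic_231_iff by metis
    then obtain a b c where "1 \<le> a" "Suc a \<le> b" "Suc b \<le> c" "c < Suc n"
        and "p a = u" "p b = v" "p c = w"
      unfolding one_line_def subseq_Cons_map_upt by (elim exE conjE)
    with uvw have "1 \<le> a" "a < b" "b < c" "c \<le> n" "p c < p a" "p a < p b" by auto
    then show "\<not> avoids_231 n p" unfolding avoids_231_def by blast
  next
    assume "\<not> avoids_231 n p"
    then obtain a b c where abc: "1 \<le> a" "a < b" "b < c" "c \<le> n" and "p c < p a" "p a < p b"
      unfolding avoids_231_def by blast
    then have "order_isomorphic [p a, p b, p c] [2, 3, 1]"
      unfolding order_isomorphic_231_iff by simp
    moreover from abc have "subseq [p c] (map p [Suc b..<Suc n])"
      unfolding subseq_Cons_map_upt by (intro exI[of _ c]) simp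
    with abc have "subseq [p b, p c] (map p [Suc a..<Suc n])"
      unfolding subseq_Cons_map_upt[of _ "[p c]"] by (intro exI[of _ b]) simp
    with abc have "subseq [p a, p b, p c] (one_line n p)"
      unfolding one_line_def subseq_Cons_map_upt[of _ "[p b, p c]"] by (intro exI[of _ a]) simp
    ultimately show "\<exists>xs. subseq xs (one_line n p) \<and> order_isomorphic xs [2, 3, 1]" by blast
  qed
  then show ?thesis by (auto simp: Av_def)
qed

lemma finite_Av: "finite (Av n s)"
  by (rule finite_subset[OF _ finite_permutations[of "{1..n}"]]) (auto simp: Av_def)

lemma inj_on_imp_permutes:
  assumes "finite A" and "inj_on p A" and "p ` A \<subseteq> A" and "\<And>x. x \<notin> A \<Longrightarrow> p x = x"
  shows "p permutes A"
  using assms by (intro bij_imp_permutes) (auto simp: bij_betw_def endo_inj_surj)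

lemma permutes_atLeastAtMost_bounds:
  assumes "p permutes {1..n}" and "1 \<le> j" and "j \<le> n"
  shows "1 \<le> p j" and "p j \<le> n"
  using permutes_in_image[OF assms(1), of j] assms(2,3) by auto

section \<open>Splitting at the position of the largest entry\<close>

text \<open>
  The guard \<open>j \<le> n\<close> makes the function fix the points beyond \<open>n\<close>; the point \<open>0\<close> is fixed because
  \<open>\<sigma>\<close> fixes it.
\<close>

definition glue :: "nat \<Rightarrow> nat \<Rightarrow> (nat \<Rightarrow> nat) \<Rightarrow> (nat \<Rightarrow> nat) \<Rightarrow> nat \<Rightarrow> nat" where
  "glue n i \<sigma> \<tau> j =
     (if j < i then \<sigma> j else if j = i then n else if j \<le> n then (i - 1) + \<tau> (j - i) else j)"

context
  fixes n i :: nat and \<sigma> \<tau> :: "nat \<Rightarrow> nat"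
  assumes i: "1 \<le> i" "i \<le> n"
    and \<sigma>: "\<sigma> permutes {1..i - 1}"
    and \<tau>: "\<tau> permutes {1..n - i}"
begin

lemma glue_left:
  assumes "1 \<le> j" and "j < i"
  shows "glue n i \<sigma> \<tau> j = \<sigma> j" and "1 \<le> \<sigma> j" and "\<sigma> j < i"
proof -
  have "j \<le> i - 1" using assms by simp
  note bounds = permutes_atLeastAtMost_bounds[OF \<sigma> assms(1) this]
  show "glue n i \<sigma> \<tau> j = \<sigma> j" using assms by (simp add: glue_def)
  show "1 \<le> \<sigma> j" by (rule bounds)
  show "\<sigma> j < i" using bounds(2) i by simp
qed

lemma glue_at: "glue n i \<sigma> \<tau> i = n"
  by (simp add: glue_def)

lemma glue_right:
  assumes "1 \<le> j" and "j \<le> n - i"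
  shows "glue n i \<sigma> \<tau> (i + j) = (i - 1) + \<tau> j" and "1 \<le> \<tau> j" and "\<tau> j \<le> n - i"
  using assms i permutes_atLeastAtMost_bounds[OF \<tau>, of j] by (auto simp: glue_def)

lemma glue_cases:
  assumes "1 \<le> j" and "j \<le> n"
  obtains (left) "j < i" "glue n i \<sigma> \<tau> j = \<sigma> j" "1 \<le> \<sigma> j" "\<sigma> j < i"
    | (at) "j = i" "glue n i \<sigma> \<tau> j = n"
    | (right) k where "j = i + k" "1 \<le> k" "k \<le> n - i" "glue n i \<sigma> \<tau> j = (i - 1) + \<tau> k"
        "1 \<le> \<tau> k" "\<tau> k \<le> n - i"
proof -
  consider "j < i" | "j = i" | "i < j" by linarith
  then show thesis
  proof cases
    case 3
    then show ?thesis
      using assms glue_right[of "j - i"] right[of "j - i"] by auto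
  qed (use assms glue_left glue_at left at in auto)
qed

lemma glue_permutes: "glue n i \<sigma> \<tau> permutes {1..n}"
proof (rule inj_on_imp_permutes)
  show "inj_on (glue n i \<sigma> \<tau>) {1..n}"
  proof (rule inj_onI)
    fix j k
    assume "j \<in> {1..n}" and "k \<in> {1..n}" and eq: "glue n i \<sigma> \<tau> j = glue n i \<sigma> \<tau> k"
    then have j: "1 \<le> j" "j \<le> n" and k: "1 \<le> k" "k \<le> n" by auto
    from j show "j = k"
    proof (cases rule: glue_cases)
      case left
      note j_left = left
      from k show ?thesis
      proof (cases rule: glue_cases)
        case left
        then have "\<sigma> j = \<sigma> k" using eq j_left by simp
        then show ?thesis by (rule injD[OF permutes_inj[OF \<sigma>]])
      qed (use eq j_left i in linarith)+
    next
      case at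
      note j_at = at
      from k show ?thesis
        by (cases rule: glue_cases) (use eq j_at i in linarith)+
    next
      case (right j')
      note j_right = right
      from k show ?thesis
      proof (cases rule: glue_cases)
        case (right k')
        then have "\<tau> j' = \<tau> k'" using eq j_right by linarith
        then have "j' = k'" by (rule injD[OF permutes_inj[OF \<tau>]])
        with right j_right show ?thesis by simp
      qed (use eq j_right i in linarith)+
    qed
  qed
  show "glue n i \<sigma> \<tau> ` {1..n} \<subseteq> {1..n}"
  proof safe
    fix j assume "j \<in> {1..n}"
    then have "1 \<le> j" "j \<le> n" by auto
    then show "glue n i \<sigma> \<tau> j \<in> {1..n}"
      by (cases rule: glue_cases) (use i in auto)
  qed
  show "glue n i \<sigma> \<tau> j = j" if "j \<notin> {1..n}" for j
    using that i permutes_not_in[OF \<sigma>, of j] by (auto simp: glue_def)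
qed auto

text \<open>
  The entry \<open>p c\<close> of an occurrence of 231 at positions \<open>a < b < c\<close> is the smallest. If \<open>a\<close> lies in
  the left block, the value \<open>p c\<close> is below \<open>i\<close>, which forces \<open>c\<close>, and with it \<open>b\<close>, into the left block;
  and the largest entry \<open>n\<close> cannot be \<open>p a\<close>. So every occurrence lies inside one block.
\<close>

lemma glue_avoids_231:
  assumes "avoids_231 (i - 1) \<sigma>" and "avoids_231 (n - i) \<tau>"
  shows "avoids_231 n (glue n i \<sigma> \<tau>)"
  unfolding avoids_231_def
proof
  let ?p = "glue n i \<sigma> \<tau>"
  assume "\<exists>a b c. 1 \<le> a \<and> a < b \<and> b < c \<and> c \<le> n \<and> ?p c < ?p a \<and> ?p a < ?p b"
  then obtain a b c where abc: "1 \<le> a" "a < b" "b < c" "c \<le> n" "?p c < ?p a" "?p a < ?p b"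
    by blast
  from abc have b: "1 \<le> b" "b \<le> n" and c: "1 \<le> c" "c \<le> n" and a: "1 \<le> a" "a \<le> n" by auto
  from a show False
  proof (cases rule: glue_cases)
    case left
    from c have "c < i"
      by (cases rule: glue_cases) (use left abc i in auto)
    then have "c \<le> i - 1" "\<sigma> c < \<sigma> a" "\<sigma> a < \<sigma> b"
      using abc glue_left(1)[of a] glue_left(1)[of b] glue_left(1)[of c] by auto
    with abc assms(1) show False unfolding avoids_231_def by blast
  next
    case at
    from b show False
      by (cases rule: glue_cases) (use at abc i in auto)
  next
    case (right a')
    with abc obtain b' c' where eqs: "b = i + b'" "c = i + c'"
      by (metis le_add1 le_Suc_ex less_imp_le_nat order.trans)
    with abc right have b': "1 \<le> b'" "b' \<le> n - i" and c': "1 \<le> c'" "c' \<le> n - i"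
      and "a' < b'" "b' < c'" by auto
    moreover from abc right have "\<tau> c' < \<tau> a'" "\<tau> a' < \<tau> b'"
      unfolding eqs glue_right(1)[OF b'] glue_right(1)[OF c'] by auto
    moreover note right(2)
    ultimately show False
      using assms(2) unfolding avoids_231_def by blast
  qed
qed

lemma glue_eq_n_iff: "glue n i \<sigma> \<tau> j = n \<longleftrightarrow> j = i"
  using inj_eq[OF permutes_inj[OF glue_permutes], of j i] by (simp add: glue_at)

end

text \<open>
  The split position is recovered as the position of \<open>n\<close>, and then both blocks can be read off.
\<close>

lemma glue_inject:
  assumes "1 \<le> i" "i \<le> n" "\<sigma> permutes {1..i - 1}" "\<tau> permutes {1..n - i}"
    and "1 \<le> i'" "i' \<le> n" "\<sigma>' permutes {1..i' - 1}" "\<tau>' permutes {1..n - i'}"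
    and eq: "glue n i \<sigma> \<tau> = glue n i' \<sigma>' \<tau>'"
  shows "i = i' \<and> \<sigma> = \<sigma>' \<and> \<tau> = \<tau>'"
proof (intro conjI)
  show ii: "i = i'"
    using glue_eq_n_iff[OF assms(5-8), of i] assms(1,2) glue_at[OF assms(1-4)] eq by simp
  show "\<sigma> = \<sigma>'"
  proof
    fix j
    show "\<sigma> j = \<sigma>' j"
    proof (cases "1 \<le> j \<and> j < i")
      case True
      then show ?thesis
        using glue_left(1)[OF assms(1-4), of j] glue_left(1)[OF assms(5-8), of j] eq ii by simp
    next
      case False
      then have "j \<notin> {1..i - 1}" by auto
      then show ?thesis
        using assms(3,7) ii by (simp add: permutes_not_in)
    qed
  qed
  show "\<tau> = \<tau>'"
  proof
    fix j
    show "\<tau> j = \<tau>' j"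
    proof (cases "1 \<le> j \<and> j \<le> n - i")
      case True
      then show ?thesis
        using glue_right(1)[OF assms(1-4), of j] glue_right(1)[OF assms(5-8), of j] eq ii by simp
    next
      case False
      then have "j \<notin> {1..n - i}" by auto
      then show ?thesis
        using assms(4,8) ii by (simp add: permutes_not_in)
    qed
  qed
qed

text \<open>
  An inversion across position \<open>i\<close> would form a 231 with the entry \<open>n\<close>. Hence all \<open>n - i\<close> entries on
  the right exceed a given left entry \<open>p j\<close> and stay below \<open>n\<close>, which bounds \<open>p j\<close> from above by
  counting; a right entry exceeds all \<open>i - 1\<close> left entries, which bounds it from below.
\<close>

lemma avoids_231_split:
  assumes p: "p permutes {1..n}" and av: "avoids_231 n p"
    and i: "1 \<le> i" "i \<le> n" "p i = n"
  shows "\<And>j. 1 \<le> j \<Longrightarrow> j < i \<Longrightarrow> p j \<le> i - 1"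
    and "\<And>k. i < k \<Longrightarrow> k \<le> n \<Longrightarrow> i \<le> p k \<and> p k \<le> n - 1"
proof -
  have less_n: "p j < n" if "1 \<le> j" "j \<le> n" "j \<noteq> i" for j
    using permutes_atLeastAtMost_bounds(2)[OF p that(1,2)] that(3) i(3)
      injD[OF permutes_inj[OF p], of j i] by (metis le_neq_implies_less)
  have less: "p j < p k" if "1 \<le> j" "j < i" "i < k" "k \<le> n" for j k
  proof (rule ccontr)
    assume "\<not> p j < p k"
    moreover have "p j \<noteq> p k"
      using that injD[OF permutes_inj[OF p], of j k] by auto
    ultimately have "p k < p j" by simp
    moreover have "p j < p i" using less_n[of j] that i by simp
    ultimately show False using av that unfolding avoids_231_def by blast
  qed
  have inj: "inj_on p A" for A
    using p by (simp add: permutes_inj_on)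
  show "p j \<le> i - 1" if j: "1 \<le> j" "j < i" for j
  proof -
    have "p ` {i<..n} \<subseteq> {p j<..<n}"
      using less[OF j] less_n i by auto
    then have "card {i<..n} \<le> card {p j<..<n}"
      by (metis card_image card_mono finite_greaterThanLessThan inj)
    moreover have "p j < n" using less_n[of j] j i by simp
    ultimately show ?thesis using i by simp
  qed
  show "i \<le> p k \<and> p k \<le> n - 1" if k: "i < k" "k \<le> n" for k
  proof
    have "p ` {1..<i} \<subseteq> {1..<p k}"
      using less[OF _ _ k] permutes_atLeastAtMost_bounds(1)[OF p] i by auto
    then have "card {1..<i} \<le> card {1..<p k}"
      by (metis card_image card_mono finite_atLeastLessThan inj)
    then show "i \<le> p k"
      using permutes_atLeastAtMost_bounds(1)[OF p, of k] k i by simp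
    show "p k \<le> n - 1" using less_n[of k] k by simp
  qed
qed

lemma glue_surj:
  assumes p: "p permutes {1..n}" and av: "avoids_231 n p" and n: "1 \<le> n"
  obtains i \<sigma> \<tau> where "1 \<le> i" "i \<le> n" "\<sigma> \<in> Av (i - 1) [2, 3, 1]" "\<tau> \<in> Av (n - i) [2, 3, 1]"
    "p = glue n i \<sigma> \<tau>"
proof -
  define i where "i = inv p n"
  have pi: "p i = n" unfolding i_def using p by (simp add: permutes_inverses)
  have i: "1 \<le> i" "i \<le> n"
    using permutes_in_image[OF p, of i] n pi by auto
  note split = avoids_231_split[OF p av i pi]
  note pinj = injD[OF permutes_inj[OF p]]
  define \<sigma> where "\<sigma> j = (if j < i then p j else j)" for j
  define \<tau> where "\<tau> j = (if 1 \<le> j \<and> j \<le> n - i then p (i + j) - (i - 1) else j)" for j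
  have \<tau>: "p (i + j) = (i - 1) + \<tau> j" "1 \<le> \<tau> j" "\<tau> j \<le> n - i" if "1 \<le> j" "j \<le> n - i" for j
  proof -
    have "i \<le> p (i + j)" "p (i + j) \<le> n - 1" using split(2)[of "i + j"] that i by auto
    then show "p (i + j) = (i - 1) + \<tau> j" "1 \<le> \<tau> j" "\<tau> j \<le> n - i"
      using that i by (auto simp: \<tau>_def)
  qed
  have "\<sigma> permutes {1..i - 1}"
  proof (rule inj_on_imp_permutes)
    show "inj_on \<sigma> {1..i - 1}"
      by (rule inj_onI) (auto simp: \<sigma>_def dest!: pinj split: if_splits)
    show "\<sigma> ` {1..i - 1} \<subseteq> {1..i - 1}"
      using split(1) permutes_atLeastAtMost_bounds(1)[OF p] i by (auto simp: \<sigma>_def)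
    show "\<sigma> j = j" if "j \<notin> {1..i - 1}" for j
    proof (cases "j = 0")
      case True
      then show ?thesis using permutes_not_in[OF p, of 0] by (simp add: \<sigma>_def)
    qed (use that in \<open>auto simp: \<sigma>_def\<close>)
  qed auto
  moreover have "avoids_231 (i - 1) \<sigma>"
    unfolding avoids_231_def
  proof
    assume "\<exists>a b c. 1 \<le> a \<and> a < b \<and> b < c \<and> c \<le> i - 1 \<and> \<sigma> c < \<sigma> a \<and> \<sigma> a < \<sigma> b"
    then obtain a b c where "1 \<le> a" "a < b" "b < c" "c \<le> i - 1" "\<sigma> c < \<sigma> a" "\<sigma> a < \<sigma> b" by blast
    then have "1 \<le> a" "a < b" "b < c" "c \<le> n" "p c < p a" "p a < p b"
      using i by (auto simp: \<sigma>_def split: if_splits)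
    then show False using av unfolding avoids_231_def by blast
  qed
  moreover have "\<tau> permutes {1..n - i}"
  proof (rule inj_on_imp_permutes)
    show "inj_on \<tau> {1..n - i}"
    proof (rule inj_onI)
      fix j k assume "j \<in> {1..n - i}" "k \<in> {1..n - i}" "\<tau> j = \<tau> k"
      then have "p (i + j) = p (i + k)" using \<tau>(1)[of j] \<tau>(1)[of k] by simp
      then show "j = k" by (auto dest: pinj)
    qed
    show "\<tau> ` {1..n - i} \<subseteq> {1..n - i}" using \<tau>(2,3) by auto
  qed (auto simp: \<tau>_def)
  moreover have "avoids_231 (n - i) \<tau>"
    unfolding avoids_231_def
  proof
    assume "\<exists>a b c. 1 \<le> a \<and> a < b \<and> b < c \<and> c \<le> n - i \<and> \<tau> c < \<tau> a \<and> \<tau> a < \<tau> b"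
    then obtain a b c where abc: "1 \<le> a" "a < b" "b < c" "c \<le> n - i" "\<tau> c < \<tau> a" "\<tau> a < \<tau> b" by blast
    then have "1 \<le> i + a" "i + a < i + b" "i + b < i + c" "i + c \<le> n"
        "p (i + c) < p (i + a)" "p (i + a) < p (i + b)"
      using i \<tau>(1)[of a] \<tau>(1)[of b] \<tau>(1)[of c] by auto
    then show False using av unfolding avoids_231_def by blast
  qed
  moreover have "p = glue n i \<sigma> \<tau>"
  proof
    fix j
    show "p j = glue n i \<sigma> \<tau> j"
      using pi \<tau>(1)[of "j - i"] permutes_not_in[OF p, of j] by (auto simp: glue_def \<sigma>_def)
  qed
  ultimately show thesis using that i by (simp add: Av_231 del: One_nat_def)
qed

text \<open>
  This is the bijection behind both the recursion for \<open>f\<close> and the Catalan count.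
\<close>

lemma bij_betw_glue:
  assumes "1 \<le> n"
  shows "bij_betw (\<lambda>(i, \<sigma>, \<tau>). glue n i \<sigma> \<tau>)
    (SIGMA i:{1..n}. Av (i - 1) [2, 3, 1] \<times> Av (n - i) [2, 3, 1]) (Av n [2, 3, 1])"
    (is "bij_betw ?g ?A ?B")
proof (rule bij_betw_imageI)
  show "inj_on ?g ?A"
  proof (rule inj_onI)
    fix s s' assume "s \<in> ?A" "s' \<in> ?A" "?g s = ?g s'"
    moreover obtain i \<sigma> \<tau> where s: "s = (i, \<sigma>, \<tau>)" by (cases s)
    moreover obtain i' \<sigma>' \<tau>' where s': "s' = (i', \<sigma>', \<tau>')" by (cases s')
    ultimately have "i \<in> {1..n}" "\<sigma> \<in> Av (i - 1) [2, 3, 1]" "\<tau> \<in> Av (n - i) [2, 3, 1]"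
      and "i' \<in> {1..n}" "\<sigma>' \<in> Av (i' - 1) [2, 3, 1]" "\<tau>' \<in> Av (n - i') [2, 3, 1]"
      and "glue n i \<sigma> \<tau> = glue n i' \<sigma>' \<tau>'"
      by auto
    then have "i = i' \<and> \<sigma> = \<sigma>' \<and> \<tau> = \<tau>'"
      unfolding Av_231 by (intro glue_inject) auto
    then show "s = s'" by (simp add: s s')
  qed
  show "?g ` ?A = ?B"
  proof (intro equalityI subsetI)
    fix p assume "p \<in> ?B"
    then have "p permutes {1..n}" "avoids_231 n p" by (auto simp only: Av_231)
    then obtain i \<sigma> \<tau> where "1 \<le> i" "i \<le> n" "\<sigma> \<in> Av (i - 1) [2, 3, 1]" "\<tau> \<in> Av (n - i) [2, 3, 1]"
        "p = glue n i \<sigma> \<tau>"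
      using assms by (rule glue_surj)
    then show "p \<in> ?g ` ?A"
      by (intro image_eqI[of _ _ "(i, \<sigma>, \<tau>)"]) auto
  next
    fix p assume "p \<in> ?g ` ?A"
    then obtain i \<sigma> \<tau> where "i \<in> {1..n}" "\<sigma> \<in> Av (i - 1) [2, 3, 1]" "\<tau> \<in> Av (n - i) [2, 3, 1]"
        and p: "p = glue n i \<sigma> \<tau>"
      by auto
    then have "1 \<le> i" "i \<le> n" "\<sigma> permutes {1..i - 1}" "\<tau> permutes {1..n - i}"
        "avoids_231 (i - 1) \<sigma>" "avoids_231 (n - i) \<tau>"
      by (auto simp only: Av_231 mem_Collect_eq atLeastAtMost_iff)
    then show "p \<in> ?B"
      unfolding p Av_231 by (simp only: mem_Collect_eq glue_permutes glue_avoids_231)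
  qed
qed

section \<open>Shifted double deficiencies of a glued permutation\<close>

text \<open>
  The position of the value \<open>j + c\<close> appears as an existential witness, which avoids computing
  the inverse of a glued permutation and the integer coercions.
\<close>

definition shifted_DD_set :: "nat \<Rightarrow> nat \<Rightarrow> (nat \<Rightarrow> nat) \<Rightarrow> nat set" where
  "shifted_DD_set n c p = {j. 1 \<le> j \<and> j + c \<le> n \<and> p j < j + c \<and> (\<exists>k>j. p k = j + c)}"

lemma finite_shifted_DD_set: "finite (shifted_DD_set n c p)"
  by (rule finite_subset[of _ "{..n}"]) (auto simp: shifted_DD_set_def)

lemma shifted_DD_eq_card:
  assumes "p permutes {1..n}"
  shows "shifted_DD n (int c) p = card (shifted_DD_set n c p)"
proof -
  have "j < inv p (j + c) \<longleftrightarrow> (\<exists>k>j. p k = j + c)" for j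
    using permutes_inv_eq[OF assms] by metis
  then have "{j \<in> {1..n}. 1 \<le> int j + int c \<and> int j + int c \<le> int n \<and>
     int (p j) < int j + int c \<and> int j + int c < int (inv p (nat (int j + int c))) + int c} =
     shifted_DD_set n c p"
    unfolding shifted_DD_set_def by (auto simp: nat_int_add simp flip: of_nat_add)
  then show ?thesis by (simp add: shifted_DD_def)
qed

text \<open>
  The positions \<open>j\<close> are sorted by where \<open>j\<close> and the value \<open>j + c\<close> lie. Both in the left block
  gives \<open>?L\<close> below, both in the right block gives \<open>?R\<close>, and \<open>?M\<close> is the interval of positions
  on the left whose value \<open>j + c\<close> is not in the left block; its length is \<open>\<Delta> n c i\<close>.
\<close>

lemma shifted_DD_glue:
  assumes i: "1 \<le> i" "i \<le> n" and \<sigma>: "\<sigma> permutes {1..i - 1}" and \<tau>: "\<tau> permutes {1..n - i}"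
    and c: "c < n"
  shows "shifted_DD n (int c) (glue n i \<sigma> \<tau>) =
    \<Delta> n c i + shifted_DD (i - 1) (int c) \<sigma> + shifted_DD (n - i) (int (c + 1)) \<tau>"
proof -
  let ?p = "glue n i \<sigma> \<tau>"
  let ?L = "shifted_DD_set (i - 1) c \<sigma>"
  let ?M = "{max 1 (i - c)..min (i - 1) (n - c)}"
  let ?R = "shifted_DD_set (n - i) (c + 1) \<tau>"
  note gl = glue_left[OF i \<sigma> \<tau>] and gr = glue_right[OF i \<sigma> \<tau>] and gp = glue_permutes[OF i \<sigma> \<tau>]
    and gcases = glue_cases[OF i \<sigma> \<tau>, consumes 2, case_names left at right]
  have pos: "k \<le> n" if "?p k = v" "v \<le> n" "1 \<le> v" for k v
    using permutes_in_image[OF gp, of k] that by auto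
  have left: "j \<in> shifted_DD_set n c ?p \<longleftrightarrow> j \<in> ?L" if "1 \<le> j" "j + c < i" for j
  proof -
    have "(\<exists>k>j. ?p k = j + c) \<longleftrightarrow> (\<exists>k>j. \<sigma> k = j + c)"
    proof (intro iffI; elim exE conjE)
      fix k assume k: "j < k" "?p k = j + c"
      then have "1 \<le> k" "k \<le> n" using pos[of k "j + c"] that i by auto
      then have "?p k = \<sigma> k"
        by (cases rule: gcases) (use k that i in auto)
      with k show "\<exists>k>j. \<sigma> k = j + c" by auto
    next
      fix k assume k: "j < k" "\<sigma> k = j + c"
      then have "k \<in> {1..i - 1}"
        using permutes_in_image[OF \<sigma>, of k] that by auto
      then have "?p k = \<sigma> k" using gl(1)[of k] i by auto
      with k show "\<exists>k>j. ?p k = j + c" by auto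
    qed
    moreover have "?p j = \<sigma> j" using gl(1)[of j] that by simp
    ultimately show ?thesis using that i by (auto simp: shifted_DD_set_def)
  qed
  have middle: "j \<in> shifted_DD_set n c ?p" if "1 \<le> j" "j < i" "i \<le> j + c" "j + c \<le> n" for j
  proof -
    let ?k = "inv ?p (j + c)"
    have k: "?p ?k = j + c" using gp by (simp add: permutes_inverses)
    \<comment> \<open>A position before \<open>i\<close> carries a value below \<open>i\<close>, but \<open>j + c \<ge> i\<close>.\<close>
    have "\<not> ?k \<le> j"
    proof
      assume "?k \<le> j"
      moreover have "1 \<le> ?k"
        using permutes_in_image[OF gp, of ?k] k that by auto
      ultimately show False using gl[of ?k] k that by simp
    qed
    then show ?thesis using k gl[of j] that by (auto simp: shifted_DD_set_def not_le)
  qed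
  have at: "i \<notin> shifted_DD_set n c ?p"
    using glue_at[OF i \<sigma> \<tau>] by (auto simp: shifted_DD_set_def)
  have right: "i + j \<in> shifted_DD_set n c ?p \<longleftrightarrow> j \<in> ?R" if "1 \<le> j" for j
  proof (cases "i + j + c < n")
    case True
    have "(\<exists>k>i + j. ?p k = i + j + c) \<longleftrightarrow> (\<exists>k>j. \<tau> k = j + (c + 1))"
    proof (intro iffI; elim exE conjE)
      fix k assume k: "i + j < k" "?p k = i + j + c"
      then have "1 \<le> k" "k \<le> n" using pos[of k "i + j + c"] True i by auto
      then show "\<exists>k>j. \<tau> k = j + (c + 1)"
      proof (cases rule: gcases)
        case (right l)
        then show ?thesis using k i by (intro exI[of _ l]) auto
      qed (use k in auto)
    next
      fix k assume k: "j < k" "\<tau> k = j + (c + 1)"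
      then have "k \<in> {1..n - i}"
        using permutes_in_image[OF \<tau>, of k] True by auto
      then show "\<exists>k>i + j. ?p k = i + j + c"
        using gr(1)[of k] k i by (intro exI[of _ "i + k"]) auto
    qed
    moreover have "?p (i + j) = (i - 1) + \<tau> j" using gr(1)[of j] that True by simp
    ultimately show ?thesis using that i True by (auto simp: shifted_DD_set_def)
  next
    case False
    \<comment> \<open>The remaining value in range is \<open>i + j + c = n\<close>, which stands at \<open>i\<close>, too far left.\<close>
    have "i + j \<notin> shifted_DD_set n c ?p"
    proof
      assume "i + j \<in> shifted_DD_set n c ?p"
      with False obtain k where "i + j < k" "?p k = n"
        by (auto simp: shifted_DD_set_def)
      then show False
        using glue_eq_n_iff[OF i \<sigma> \<tau>, of k] pos[of k n] i that by auto
    qed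
    moreover have "j \<notin> ?R" using False by (auto simp: shifted_DD_set_def)
    ultimately show ?thesis by simp
  qed
  have "shifted_DD_set n c ?p = ?M \<union> ?L \<union> (+) i ` ?R"
  proof (rule set_eqI)
    fix j
    consider "j = 0" | "1 \<le> j" "j + c < i" | "1 \<le> j" "j < i" "i \<le> j + c" | "j = i"
      | k where "j = i + k" "1 \<le> k"
      by (metis less_one linorder_neqE_nat not_le less_imp_add_positive Suc_leI One_nat_def)
    then show "j \<in> shifted_DD_set n c ?p \<longleftrightarrow> j \<in> ?M \<union> ?L \<union> (+) i ` ?R"
    proof cases
      case 1
      then show ?thesis using i by (auto simp: shifted_DD_set_def)
    next
      case 2
      then show ?thesis using left by (auto simp: shifted_DD_set_def)
    next
      case 3
      then show ?thesis using middle[of j] by (auto simp: shifted_DD_set_def)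
    next
      case 4
      then show ?thesis using at i by (auto simp: shifted_DD_set_def)
    next
      case 5
      then show ?thesis using right i by (auto simp: shifted_DD_set_def)
    qed
  qed
  moreover have "?M \<inter> ?L = {}" "(?M \<union> ?L) \<inter> (+) i ` ?R = {}"
    using i by (auto simp: shifted_DD_set_def)
  ultimately have "card (shifted_DD_set n c ?p) = card ?M + card ?L + card ?R"
    by (simp add: card_Un_disjoint finite_shifted_DD_set card_image)
  moreover have "card ?M = \<Delta> n c i"
    using i c by (auto simp: \<Delta>_def min_def max_def)
  ultimately show ?thesis
    by (simp only: shifted_DD_eq_card[OF gp] shifted_DD_eq_card[OF \<sigma>] shifted_DD_eq_card[OF \<tau>])
qed

section \<open>Catalan numbers\<close>

lemma Suc_mult_catalan: "(n + 1) * catalan n = (2 * n) choose n"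
  using real_catalan[of n] by (simp add: field_simps flip: of_nat_mult of_nat_add of_nat_Suc)

lemma catalan_0 [simp]: "catalan 0 = 1"
  by (simp add: catalan_def)

lemma catalan_Suc: "(n + 2) * catalan (Suc n) = (4 * n + 2) * catalan n"
proof -
  have "Suc n * ((n + 2) * catalan (Suc n)) = Suc n * ((2 * Suc n) choose Suc n)"
    using Suc_mult_catalan[of "Suc n"] by simp
  also have "\<dots> = 2 * ((n + 1) * ((2 * n + 1) choose n))"
    using Suc_times_binomial[of n "2 * n + 1"] by simp
  also have "(n + 1) * ((2 * n + 1) choose n) = (2 * n + 1) * ((n + 1) * catalan n)"
    using binomial_absorb_comp[of "2 * n + 1" n] unfolding Suc_mult_catalan by simp
  also have "2 * ((2 * n + 1) * ((n + 1) * catalan n)) = Suc n * ((4 * n + 2) * catalan n)"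
    by (simp add: algebra_simps)
  finally have "Suc n * ((n + 2) * catalan (Suc n)) = Suc n * ((4 * n + 2) * catalan n)" .
  then show ?thesis by (simp del: mult_Suc)
qed

text \<open>
  The reflection \<open>i \<mapsto> n - i\<close> preserves the product, so the weight \<open>i\<close> averages to \<open>n / 2\<close>.
\<close>

lemma sum_weighted_convolution:
  fixes a :: "nat \<Rightarrow> nat"
  shows "2 * (\<Sum>i\<le>n. i * (a i * a (n - i))) = n * (\<Sum>i\<le>n. a i * a (n - i))"
proof -
  have "(\<Sum>i\<le>n. i * (a i * a (n - i))) = (\<Sum>i\<le>n. (n - i) * (a i * a (n - i)))"
    by (rule sum.reindex_bij_witness[of _ "\<lambda>i. n - i" "\<lambda>i. n - i"]) (auto simp: mult.commute)
  then have "2 * (\<Sum>i\<le>n. i * (a i * a (n - i))) =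
      (\<Sum>i\<le>n. i * (a i * a (n - i)) + (n - i) * (a i * a (n - i)))"
    by (simp add: sum.distrib)
  also have "\<dots> = (\<Sum>i\<le>n. n * (a i * a (n - i)))"
    by (rule sum.cong) (auto simp flip: distrib_right)
  finally show ?thesis by (simp add: sum_distrib_left)
qed

text \<open>
  Write \<open>C\<close> for the Catalan numbers, \<open>T m\<close> for the convolution sum, and \<open>S m\<close> for the same sum
  with weight \<open>i\<close>. By symmetry \<open>2 * S m = m * T m\<close>, so the sum with weight \<open>i + 1\<close> at
  \<open>Suc n\<close> is \<open>(n + 3) / 2\<close> times \<open>T (Suc n)\<close>. On the other hand the first-order recursion
  \<open>catalan_Suc\<close> turns the weighted \<open>(i + 2) * C (Suc i)\<close> into \<open>(4 * i + 2) * C i\<close>, which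
  expresses that sum through \<open>C (Suc n)\<close>, \<open>S n\<close> and \<open>T n\<close>. Comparing the two gives a first-order recursion for
  \<open>T\<close>, and with \<open>T n = C (n + 1)\<close> it becomes the one that \<open>C\<close> satisfies.
\<close>

lemma catalan_convolution: "catalan (Suc n) = (\<Sum>i\<le>n. catalan i * catalan (n - i))"
proof (induction n)
  case 0
  show ?case using catalan_Suc[of 0] by simp
next
  case (Suc n)
  define T where "T m = (\<Sum>i\<le>m. catalan i * catalan (m - i))" for m
  define S where "S m = (\<Sum>i\<le>m. i * (catalan i * catalan (m - i)))" for m
  have S: "2 * S m = m * T m" for m
    unfolding S_def T_def by (rule sum_weighted_convolution)
  have "S (Suc n) + T (Suc n) = (\<Sum>i\<le>Suc n. (i + 1) * catalan i * catalan (Suc n - i))"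
    by (simp only: S_def T_def flip: sum.distrib) (simp add: algebra_simps)
  also have "\<dots> = catalan (Suc n) + (\<Sum>i\<le>n. (i + 2) * catalan (Suc i) * catalan (n - i))"
    by (simp only: sum.atMost_Suc_shift) simp
  also have "(\<Sum>i\<le>n. (i + 2) * catalan (Suc i) * catalan (n - i)) = 4 * S n + 2 * T n"
    unfolding catalan_Suc
    by (simp add: S_def T_def sum_distrib_left algebra_simps flip: sum.distrib)
  finally have "(n + 3) * T (Suc n) = 2 * catalan (Suc n) + (4 * n + 4) * T n"
    using S[of n] S[of "Suc n"] by (simp add: algebra_simps)
  also have "T n = catalan (Suc n)" using Suc.IH by (simp add: T_def)
  finally have "(n + 3) * T (Suc n) = (n + 3) * catalan (Suc (Suc n))"
    using catalan_Suc[of "Suc n"] by (simp add: algebra_simps)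
  then show ?case by (simp add: T_def)
qed

lemma Av_0: "Av 0 [2, 3, 1] = {id}"
  by (auto simp: Av_231 avoids_231_def simp del: One_nat_def)

lemma card_Av_231: "card (Av n [2, 3, 1]) = catalan n"
proof (induction n rule: less_induct)
  case (less n)
  show ?case
  proof (cases n)
    case 0
    then show ?thesis by (simp add: Av_0 del: One_nat_def)
  next
    case (Suc m)
    have "card (Av n [2, 3, 1]) =
        card (SIGMA i:{1..n}. Av (i - 1) [2, 3, 1] \<times> Av (n - i) [2, 3, 1])"
      using bij_betw_same_card[OF bij_betw_glue[of n]] Suc by simp
    also have "\<dots> = (\<Sum>i=1..n. card (Av (i - 1) [2, 3, 1]) * card (Av (n - i) [2, 3, 1]))"
      by (simp add: finite_Av card_cartesian_product del: One_nat_def)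
    also have "\<dots> = (\<Sum>i=1..n. catalan (i - 1) * catalan (n - i))"
      by (intro sum.cong refl arg_cong2[of _ _ _ _ "(*)"] less.IH) auto
    also have "\<dots> = (\<Sum>i\<le>m. catalan i * catalan (m - i))"
      unfolding Suc by (rule sum.reindex_bij_witness[of _ Suc "\<lambda>i. i - 1"]) auto
    finally show ?thesis using catalan_convolution[of m] Suc by simp
  qed
qed

section \<open>The recursion\<close>

lemma f_recursion:
  fixes x :: "'a::comm_semiring_1"
  assumes "c < n"
  shows "f n c x = (\<Sum>i=1..n. x ^ \<Delta> n c i * f (i - 1) c x * f (n - i) (c + 1) x)"
proof -
  have "f n c x = (\<Sum>(i, \<sigma>, \<tau>)\<in>(SIGMA i:{1..n}. Av (i - 1) [2, 3, 1] \<times> Av (n - i) [2, 3, 1]).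
      x ^ shifted_DD n (int c) (glue n i \<sigma> \<tau>))"
    unfolding f_def using assms
    by (subst sum.reindex_bij_betw[OF bij_betw_glue, symmetric]) (auto simp: case_prod_unfold)
  also have "\<dots> = (\<Sum>i=1..n. \<Sum>(\<sigma>, \<tau>)\<in>Av (i - 1) [2, 3, 1] \<times> Av (n - i) [2, 3, 1].
      x ^ shifted_DD n (int c) (glue n i \<sigma> \<tau>))"
    by (subst sum.Sigma) (auto simp: finite_Av)
  also have "\<dots> = (\<Sum>i=1..n. \<Sum>(\<sigma>, \<tau>)\<in>Av (i - 1) [2, 3, 1] \<times> Av (n - i) [2, 3, 1].
      x ^ \<Delta> n c i * (x ^ shifted_DD (i - 1) (int c) \<sigma> * x ^ shifted_DD (n - i) (int (c + 1)) \<tau>))"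
    using assms
    by (intro sum.cong refl) (auto simp: Av_231 shifted_DD_glue power_add mult.assoc simp del: One_nat_def of_nat_add)
  also have "\<dots> = (\<Sum>i=1..n. x ^ \<Delta> n c i * f (i - 1) c x * f (n - i) (c + 1) x)"
    unfolding f_def case_prod_unfold mult.assoc sum_product sum.cartesian_product
    by (simp only: sum_distrib_left[symmetric])
  finally show ?thesis .
qed

lemma f_eq_catalan:
  fixes x :: "'a::comm_semiring_1"
  assumes "n \<le> c"
  shows "f n c x = of_nat (catalan n)"
proof -
  have "shifted_DD n (int c) p = 0" for p
    using assms by (auto simp: shifted_DD_def)
  then show ?thesis by (simp add: f_def card_Av_231 del: One_nat_def)
qed

lemma f231_eq_f: "f231 n x = f n 0 x"
proof -
  have "DD n p = shifted_DD n (int 0) p" for p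
    unfolding DD_def shifted_DD_def by (rule arg_cong[of _ _ card]) auto
  then show ?thesis by (simp add: f231_def f_def)
qed

theorem proposition8:
  fixes x :: "'a::comm_semiring_1"
  shows "(\<forall>n c. 1 \<le> n \<and> c < n \<longrightarrow>
            f n c x = (\<Sum>i=1..n. x ^ \<Delta> n c i * f (i - 1) c x * f (n - i) (c + 1) x))
       \<and> (\<forall>c. f 0 c x = 1)
       \<and> (\<forall>n c. n \<le> c \<longrightarrow> f n c x = of_nat (catalan n))
       \<and> (\<forall>n. f231 n x = f n 0 x)"
proof (intro conjI allI impI)
  show "f 0 c x = 1" for c
    using f_eq_catalan[of 0 c x] by simp
qed (use f_recursion f_eq_catalan f231_eq_f in auto)

end
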